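(* Let $A=[a_{ij}]\in\mathbb{R}^{n\times n}$ be a nonnegative matrix with zero diagonal and let $\alpha_1,\dots,\alpha_n\in(0,1)$. Consider the system $\dot x_i(t)=u_i(t)$, $i=1,\dots,n$, with $x_i(t)\in\mathbb{R}$ and $$u_i=\operatorname{sig}\Big(\sum_{j\in N_i}a_{ij}(x_j-x_i)\Big)^{\alpha_i},\qquad N_i=\{j\neq i: a_{ij}>0\}$$ (with $u_i=0$ if $N_i=\emptyset$). If the directed graph $\mathcal{G}(A)$ has a spanning tree, then this system solves a finite-time consensus problem.
   Context: For $r\in\mathbb{R}$ and $\alpha>0$, $\operatorname{sig}(r)^\alpha:=\operatorname{sign}(r)|r|^\alpha$, with $\operatorname{sign}(0)=0$. The weighted directed graph $\mathcal{G}(A)$ has vertices $v_1,\dots,v_n$ and an edge $(v_i,v_j)$ (from $v_i$ to $v_j$) if and only if $a_{ji}>0$. It has a spanning tree if a subset of its edges forms a directed tree on all the vertices, i.e. there is a root vertex from which every other vertex can be reached by a directed path. The right-hand side is continuous but not Lipschitz; solutions are differentiable functions on $[0,\infty)$. The system solves a consensus problem if for every initial state $x(0)\in\mathbb{R}^n$, every solution $x(t)$ on $[0,\infty)$ with that initial state, and all $j,k$, $|x_j(t)-x_k(t)|\to0$ as $t\to\infty$. It solves a finite-time consensus problem if in addition, for every initial state and every such solution, there exist a time $t^*$ and a real number $\kappa$ such that $x_j(t)=\kappa$ for all $t\ge t^*$ and all $j$. *)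

theory Defs
  imports "HOL-Analysis.Analysis"
begin

definition sig :: "real \<Rightarrow> real \<Rightarrow> real" where
  "sig r a = sgn r * \<bar>r\<bar> powr a"


(* A directed graph is given by its edge relation; its vertices are all elements of the type. *)

(* Edges point in the direction of information flow: the entry with row j and column i
   is the weight of the edge from i to j. *)
definition graph_edges :: "real^'n^'n \<Rightarrow> 'n rel" where
  "graph_edges A = {(i, j). A $ j $ i > 0}"

definition directed_tree :: "'v rel \<Rightarrow> bool" where
  "directed_tree T \<longleftrightarrow>
     (\<exists>r. (\<forall>u. (u, r) \<notin> T) \<and> (\<forall>v. v \<noteq> r \<longrightarrow> (\<exists>!u. (u, v) \<in> T)) \<and> (\<forall>v. (r, v) \<in> T\<^sup>*))"

definition has_spanning_tree :: "'v rel \<Rightarrow> bool" where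
  "has_spanning_tree E \<longleftrightarrow> (\<exists>T. T \<subseteq> E \<and> directed_tree T)"

lemma has_spanning_tree_iff_root:
  "has_spanning_tree E \<longleftrightarrow> (\<exists>r. \<forall>v. (r, v) \<in> E\<^sup>*)"
proof
  assume "has_spanning_tree E"
  then show "\<exists>r. \<forall>v. (r, v) \<in> E\<^sup>*"
    unfolding has_spanning_tree_def directed_tree_def by (meson rtrancl_mono subsetD)
next
  assume "\<exists>r. \<forall>v. (r, v) \<in> E\<^sup>*"
  then obtain r where r: "\<And>v. (r, v) \<in> E\<^sup>*" by blast
  define d where "d v = (LEAST k. (r, v) \<in> E ^^ k)" for v
  have d: "(r, v) \<in> E ^^ d v" for v
    unfolding d_def using r[of v] by (metis LeastI rtrancl_imp_relpow)
  have dle: "d v \<le> k" if "(r, v) \<in> E ^^ k" for v k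
    unfolding d_def using that by (rule Least_le)
  have "\<exists>u. (u, v) \<in> E \<and> d u < d v" if "v \<noteq> r" for v
  proof (cases "d v")
    case 0
    then show ?thesis using d[of v] that by simp
  next
    case (Suc k)
    then obtain u where u: "(r, u) \<in> E ^^ k" "(u, v) \<in> E"
      using d[of v] by auto
    then show ?thesis using dle[OF u(1)] Suc by auto
  qed
  then obtain p where p: "\<And>v. v \<noteq> r \<Longrightarrow> (p v, v) \<in> E \<and> d (p v) < d v" by metis
  define T where "T = {(p v, v) | v. v \<noteq> r}"
  have "(r, v) \<in> T\<^sup>*" for v
  proof (induction "d v" arbitrary: v rule: less_induct)
    case less
    show ?case
    proof (cases "v = r")
      case False
      then have "(r, p v) \<in> T\<^sup>*" "(p v, v) \<in> T"
        using less[of "p v"] p[of v] by (auto simp: T_def)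
      then show ?thesis by (rule rtrancl.rtrancl_into_rtrancl)
    qed simp
  qed
  moreover have "T \<subseteq> E" using p by (auto simp: T_def)
  ultimately show "has_spanning_tree E"
    unfolding has_spanning_tree_def directed_tree_def
    by (intro exI[of _ T] conjI exI[of _ r]) (auto simp: T_def)
qed


(* The derivative at 0 is one-sided; values at negative times play no role. *)
definition solution_from :: "(real^'n \<Rightarrow> real^'n) \<Rightarrow> real^'n \<Rightarrow> (real \<Rightarrow> real^'n) \<Rightarrow> bool" where
  "solution_from f x0 x \<longleftrightarrow>
     x 0 = x0 \<and>
     (\<forall>t\<ge>0. \<forall>i. ((\<lambda>s. x s $ i) has_real_derivative f (x t) $ i) (at t within {0..}))"

definition solves_consensus :: "(real^'n \<Rightarrow> real^'n) \<Rightarrow> bool" where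
  "solves_consensus f \<longleftrightarrow>
     (\<forall>x0 x. solution_from f x0 x \<longrightarrow>
        (\<forall>j k. ((\<lambda>t. \<bar>x t $ j - x t $ k\<bar>) \<longlongrightarrow> 0) at_top))"

definition solves_finite_time_consensus :: "(real^'n \<Rightarrow> real^'n) \<Rightarrow> bool" where
  "solves_finite_time_consensus f \<longleftrightarrow>
     solves_consensus f \<and>
     (\<forall>x0 x. solution_from f x0 x \<longrightarrow>
        (\<exists>t'\<ge>0. \<exists>\<kappa>. \<forall>t\<ge>t'. \<forall>j. x t $ j = \<kappa>))"

definition neighbours :: "real^'n^'n \<Rightarrow> 'n \<Rightarrow> 'n set" where
  "neighbours A i = {j. j \<noteq> i \<and> A $ i $ j > 0}"

definition consensus_protocol :: "real^'n^'n \<Rightarrow> real^'n \<Rightarrow> real^'n \<Rightarrow> real^'n" where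
  "consensus_protocol A \<alpha> x =
     (\<chi> i. sig (\<Sum>j\<in>neighbours A i. A $ i $ j * (x $ j - x $ i)) (\<alpha> $ i))"

lemma consensus_protocol_no_neighbours:
  "neighbours A i = {} \<Longrightarrow> consensus_protocol A \<alpha> x $ i = 0"
  by (simp add: consensus_protocol_def sig_def)

end

theory Submission
  imports Defs
begin

text \<open>
  Put $y_i = \sum_j a_{ij} (x_j - x_i)$ and $s_i = \mathrm{sig}(y_i)^{\alpha_i}$, so that
  $\dot x_i = s_i$ and $\dot y_i = \sum_j a_{ij} (s_j - s_i)$.  For positive weights $w_i$ the energy
  $V = \sum_i \frac{w_i}{1 + \alpha_i} |y_i|^{1 + \alpha_i}$ has derivative
  $\dot V = - Q(s)$ with $Q(s) = \sum_{i,j} w_i a_{ij} s_i (s_i - s_j)$, because the derivative of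
  $|y|^{1+\alpha} / (1+\alpha)$ is $\mathrm{sig}(y)^\alpha$.  The proof finds weights for which
  $Q(s) \ge c |s|^2$ along every solution.  Since $s_i^2 = (|y_i|^{1+\alpha_i})^{e_i}$ with
  $e_i = 2 \alpha_i / (1 + \alpha_i) < 1$, this gives $\dot V \le - k V^\gamma$ with $\gamma < 1$, and such
  an energy vanishes after a finite time.  From then on $y = 0$: the state no longer moves, and by the
  maximum principle the only states with $y = 0$ are the constant ones.

  For the choice of weights, $2 Q(s) = \sum_{i,j} w_i a_{ij} (s_i - s_j)^2 + \sum_k g_k s_k^2$, where
  $g = w^T L$ and $L$ is the graph Laplacian (the function \<open>drift\<close> below is $g$).  A stationary
  distribution $p$, which exists by Brouwer's fixed point theorem, has $g = 0$, but its
  support $S$ may be a proper subset: it is closed under passing to in-neighbours, hence contains the root, and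
  the vertices outside $S$ carry no weight.  On $S$ the first sum
  suffices: every vertex of $S$ is joined to the root inside $S$, so the sum bounds all differences
  $s_i - s_j$ there, and $\sum_i p_i y_i = 0$ forces $s$ to take both signs on $S$ (or vanish), so it bounds
  the $s_i$ themselves.  For the vertices outside $S$, a second stationary distribution, of the chain in which $S$
  feeds back into its complement, provides weights $v$ living outside $S$ with $g$ a positive constant
  there; $v$ may have negative $g$ on $S$, but $w = p + \delta v$ with small $\delta > 0$ lets
  the first estimate absorb it (lemma \<open>coercive_weights_exist\<close>).  Treating both parts of the graph
  with one energy avoids an induction over the strongly connected components.
\<close>

section \<open>Stationary weights and the drift of a weighted Laplacian\<close>

text \<open>
  The vector $w^T L$ for the Laplacian $L$ of $a$: read as a flow with rate $w_i a_{ij}$ from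
  \<open>i\<close> to \<open>j\<close>, it is what leaves \<open>k\<close> minus what arrives at \<open>k\<close>.
\<close>
definition drift :: "('n::finite \<Rightarrow> 'n \<Rightarrow> real) \<Rightarrow> ('n \<Rightarrow> real) \<Rightarrow> 'n \<Rightarrow> real" where
  "drift a w k = w k * (\<Sum>j\<in>UNIV. a k j) - (\<Sum>i\<in>UNIV. w i * a i k)"

definition disagreement :: "('n::finite \<Rightarrow> 'n \<Rightarrow> real) \<Rightarrow> ('n \<Rightarrow> real) \<Rightarrow> ('n \<Rightarrow> real) \<Rightarrow> real" where
  "disagreement a w s = (\<Sum>i\<in>UNIV. \<Sum>j\<in>UNIV. w i * a i j * (s i - s j)\<^sup>2)"

text \<open>
  An explicit Euler step of the flow, taken so short that no coordinate loses more than it has, maps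
  the probability simplex to itself; its fixed points are the stationary distributions.
\<close>

lemma stationary_distribution_exists:
  fixes a :: "'n::finite \<Rightarrow> 'n \<Rightarrow> real"
  assumes nonneg: "\<And>i j. a i j \<ge> 0"
  shows "\<exists>w. (\<forall>i. w i \<ge> 0) \<and> sum w UNIV = 1 \<and> (\<forall>k. drift a w k = 0)"
proof -
  define d where "d = 1 + (\<Sum>k\<in>UNIV. \<Sum>j\<in>UNIV. a k j)"
  define step where "step w = (\<chi> k. w $ k - drift a (($) w) k / d)" for w :: "real^'n"
  define K where "K = {w :: real^'n. (\<forall>i. 0 \<le> w $ i) \<and> sum (($) w) UNIV = 1}"
  have row: "(\<Sum>j\<in>UNIV. a k j) \<le> d" for k
  proof -
    have "(\<Sum>j\<in>UNIV. a k j) \<le> (\<Sum>k\<in>UNIV. \<Sum>j\<in>UNIV. a k j)"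
      by (rule member_le_sum) (auto intro: sum_nonneg nonneg)
    then show ?thesis by (simp add: d_def)
  qed
  have "0 \<le> (\<Sum>k\<in>UNIV. \<Sum>j\<in>UNIV. a k j)" by (intro sum_nonneg nonneg)
  then have d: "d > 0" by (simp add: d_def)
  have "closed K"
    unfolding K_def by (intro closed_Collect_conj closed_Collect_all closed_Collect_le
        closed_Collect_eq continuous_intros)
  moreover have "bounded K"
    unfolding bounded_iff
  proof (intro exI ballI)
    fix w assume "w \<in> K"
    then have "(\<Sum>i\<in>UNIV. \<bar>w $ i\<bar>) = 1" by (simp add: K_def)
    then show "norm w \<le> 1" using norm_le_l1_cart[of w] by simp
  qed
  ultimately have "compact K" by (simp add: compact_eq_bounded_closed)
  moreover have "convex K"
    by (auto simp: convex_def K_def sum.distrib simp flip: sum_distrib_left)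
  moreover have "(\<chi> i. 1 / real CARD('n)) \<in> K" by (simp add: K_def)
  then have "K \<noteq> {}" by blast
  moreover have "continuous_on K step"
    unfolding step_def drift_def
    by (intro continuous_on_vec_lambda continuous_intros) (use d in auto)
  moreover have "step ` K \<subseteq> K"
  proof
    fix v assume "v \<in> step ` K"
    then obtain w where w: "w \<in> K" and v: "v = step w" by blast
    have w0: "0 \<le> w $ i" for i using w by (simp add: K_def)
    have "v $ k \<ge> 0" for k
    proof -
      have "w $ k * (\<Sum>j\<in>UNIV. a k j) \<le> w $ k * d" by (intro mult_left_mono row w0)
      moreover have "0 \<le> (\<Sum>i\<in>UNIV. w $ i * a i k)" by (intro sum_nonneg mult_nonneg_nonneg w0 nonneg)
      ultimately have "drift a (($) w) k \<le> w $ k * d" by (simp add: drift_def)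
      then show ?thesis using d by (simp add: v step_def divide_simps)
    qed
    moreover have "sum (($) v) UNIV = 1"
    proof -
      have "(\<Sum>k\<in>UNIV. \<Sum>i\<in>UNIV. w $ i * a i k) = (\<Sum>k\<in>UNIV. w $ k * (\<Sum>j\<in>UNIV. a k j))"
        by (subst sum.swap) (simp add: sum_distrib_left)
      then have "(\<Sum>k\<in>UNIV. drift a (($) w) k) = 0"
        by (simp add: drift_def sum_subtractf)
      then show ?thesis using w
        by (simp add: v step_def K_def sum_subtractf flip: sum_divide_distrib)
    qed
    ultimately show "v \<in> K" by (simp add: K_def)
  qed
  ultimately obtain w where w: "w \<in> K" "step w = w" using brouwer[of K step] by (metis image_subset_iff_funcset)
  have "drift a (($) w) k = 0" for k
  proof -
    have "step w $ k = w $ k" using w by simp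
    then show ?thesis using d by (simp add: step_def)
  qed
  then show ?thesis using w(1) by (intro exI[of _ "($) w"]) (simp add: K_def)
qed

text \<open>
  A vertex that receives flow must emit flow, so it carries weight.  In the graph, \<open>a i k > 0\<close> is an edge from
  \<open>k\<close> to \<open>i\<close>: the support spreads against the edges, towards the root.
\<close>

lemma support_closed:
  fixes a :: "'n::finite \<Rightarrow> 'n \<Rightarrow> real"
  assumes a: "\<And>i j. a i j \<ge> 0" and w: "\<And>i. w i \<ge> 0" and stat: "drift a w k = 0"
    and "w i > 0" "a i k > 0"
  shows "w k > 0"
proof -
  have "w i * a i k \<le> (\<Sum>i\<in>UNIV. w i * a i k)"
    by (rule member_le_sum) (auto intro!: mult_nonneg_nonneg a w)
  moreover have "0 < w i * a i k" using assms by simp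
  ultimately have "0 < w k * (\<Sum>j\<in>UNIV. a k j)" using stat by (simp add: drift_def)
  then have "w k \<noteq> 0" by auto
  then show ?thesis using w[of k] by simp
qed

lemma root_inherits:
  assumes "(r, i) \<in> E\<^sup>*" "P i" and closed: "\<And>j i. (j, i) \<in> E \<Longrightarrow> P i \<Longrightarrow> P j"
  shows "P r"
  using assms(1,2) by (induction rule: rtrancl_induct) (auto dest: closed)

section \<open>Weights that make the dissipation coercive\<close>

text \<open>
  Symmetrising the quadratic form $Q$ by $2 s_i (s_i - s_j) = (s_i - s_j)^2 + s_i^2 - s_j^2$; the
  difference of squares sums by parts to the drift.
\<close>

lemma dissipation_identity:
  fixes a :: "'n::finite \<Rightarrow> 'n \<Rightarrow> real"
  shows "2 * (\<Sum>i\<in>UNIV. w i * s i * (\<Sum>j\<in>UNIV. a i j * (s i - s j)))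
       = disagreement a w s + (\<Sum>i\<in>UNIV. drift a w i * (s i)\<^sup>2)"
proof -
  have "(\<Sum>i\<in>UNIV. (\<Sum>k\<in>UNIV. w k * a k i) * (s i)\<^sup>2) = (\<Sum>i\<in>UNIV. \<Sum>j\<in>UNIV. w i * a i j * (s j)\<^sup>2)"
    by (subst sum.swap) (simp add: sum_distrib_right)
  then have "(\<Sum>i\<in>UNIV. drift a w i * (s i)\<^sup>2)
      = (\<Sum>i\<in>UNIV. \<Sum>j\<in>UNIV. w i * a i j * ((s i)\<^sup>2 - (s j)\<^sup>2))"
    by (simp add: drift_def left_diff_distrib right_diff_distrib sum_subtractf
        sum_distrib_left sum_distrib_right mult_ac)
  then show ?thesis
    unfolding disagreement_def
    by (simp add: sum_distrib_left flip: sum.distrib)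
       (intro sum.cong refl, simp add: power2_eq_square algebra_simps)
qed

lemma disagreement_nonneg:
  assumes "\<And>i j. a i j \<ge> 0" "\<And>i. w i \<ge> 0"
  shows "disagreement a w s \<ge> 0"
  unfolding disagreement_def by (intro sum_nonneg mult_nonneg_nonneg assms) auto

lemma disagreement_bounds_edge:
  fixes a :: "'n::finite \<Rightarrow> 'n \<Rightarrow> real"
  assumes a: "\<And>i j. a i j \<ge> 0" and w: "\<And>i. w i \<ge> 0"
  shows "w i * a i j * (s i - s j)\<^sup>2 \<le> disagreement a w s"
proof -
  have "w i * a i j * (s i - s j)\<^sup>2 \<le> (\<Sum>j\<in>UNIV. w i * a i j * (s i - s j)\<^sup>2)"
    by (rule member_le_sum) (auto intro!: mult_nonneg_nonneg a w)
  also have "\<dots> \<le> disagreement a w s"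
    unfolding disagreement_def
    by (rule member_le_sum[where f = "\<lambda>i. \<Sum>j\<in>UNIV. w i * a i j * (s i - s j)\<^sup>2"])
       (auto intro!: sum_nonneg mult_nonneg_nonneg a w)
  finally show ?thesis .
qed

text \<open>
  Edges of zero weight contribute nothing to the disagreement, so the path must stay in the support of
  \<open>w\<close>; it does, because the support is closed under passing to in-neighbours and the path ends in it.
\<close>

lemma disagreement_bounds_path:
  fixes a :: "'n::finite \<Rightarrow> 'n \<Rightarrow> real"
  assumes a: "\<And>i j. a i j \<ge> 0" and w: "\<And>i. w i \<ge> 0" and stat: "\<And>k. drift a w k = 0"
    and path: "(r, i) \<in> {(j, i). a i j > 0}\<^sup>*" and "w i > 0"
  shows "\<exists>C\<ge>0. \<forall>s. (s r - s i)\<^sup>2 \<le> C * disagreement a w s"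
  using path \<open>w i > 0\<close>
proof (induction rule: rtrancl_induct)
  case base
  show ?case by (intro exI[of _ 0]) simp
next
  case (step j i)
  have aij: "a i j > 0" using step.hyps by simp
  then have "w j > 0" using support_closed[OF a w stat] step.prems by blast
  then obtain C where C: "C \<ge> 0" "\<And>s. (s r - s j)\<^sup>2 \<le> C * disagreement a w s"
    using step.IH by blast
  define D where "D = w i * a i j"
  have D: "D > 0" using aij step.prems by (simp add: D_def)
  have "(s r - s i)\<^sup>2 \<le> (2 * C + 2 / D) * disagreement a w s" for s
  proof -
    have "D * (s i - s j)\<^sup>2 \<le> disagreement a w s"
      unfolding D_def by (rule disagreement_bounds_edge[OF a w])
    then have "(s i - s j)\<^sup>2 \<le> disagreement a w s / D" using D by (simp add: field_simps)
    moreover have "(s r - s i)\<^sup>2 \<le> 2 * (s r - s j)\<^sup>2 + 2 * (s i - s j)\<^sup>2"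
      using zero_le_power2[of "(s r - s j) + (s i - s j)"] by (simp add: power2_eq_square algebra_simps)
    ultimately show ?thesis using C(2)[of s] by (simp add: algebra_simps)
  qed
  then show ?case using C(1) D by (intro exI[of _ "2 * C + 2 / D"]) simp
qed

text \<open>
  With \<open>S\<close> the support of a stationary distribution, these weights handle the vertices without
  stationary weight.  Outside \<open>S\<close> they are the stationary weights of a modified chain in which every vertex of \<open>S\<close> sends its flow to all vertices
  outside \<open>S\<close> at rate 1.  Each of the latter then receives the same amount \<open>\<sigma>\<close>, the total weight
  of \<open>S\<close>, which is exactly the excess that appears when the weights on \<open>S\<close> are deleted.
\<close>

lemma follower_weights_exist:
  fixes a :: "'n::finite \<Rightarrow> 'n \<Rightarrow> real"
  assumes a: "\<And>i j. a i j \<ge> 0" and reach: "\<And>i. (r, i) \<in> {(j, i). a i j > 0}\<^sup>*" and "r \<in> S"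
  shows "\<exists>v \<sigma>. \<sigma> > 0 \<and> (\<forall>i\<in>S. v i = 0) \<and> (\<forall>i. i \<notin> S \<longrightarrow> v i > 0 \<and> drift a v i = \<sigma>)"
proof -
  define b where "b i j = (if i \<in> S then if j \<in> S then 0 else 1 else a i j)" for i j
  have b: "b i j \<ge> 0" for i j using a by (simp add: b_def)
  obtain w where w: "\<And>i. w i \<ge> 0" "sum w UNIV = 1" "\<And>k. drift b w k = 0"
    using stationary_distribution_exists[of b, OF b] by blast
  define \<sigma> where "\<sigma> = (\<Sum>i\<in>S. w i)"
  define v where "v i = (if i \<in> S then 0 else w i)" for i
  have drift_v: "drift a v k = \<sigma>" if "k \<notin> S" for k
  proof -
    have "(\<Sum>i\<in>UNIV. w i * b i k) = (\<Sum>i\<in>UNIV. v i * a i k + (if i \<in> S then w i else 0))"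
      using that by (intro sum.cong) (auto simp: b_def v_def)
    also have "\<dots> = (\<Sum>i\<in>UNIV. v i * a i k) + \<sigma>"
      by (simp add: sum.distrib \<sigma>_def sum.If_cases)
    finally show ?thesis using w(3)[of k] that by (simp add: drift_def b_def v_def)
  qed
  (* Without weight on S the modified chain would agree with a on the support, and the
     weight would spread to the root, which lies in S. *)
  have "\<exists>i\<in>S. w i > 0"
  proof (rule ccontr)
    assume none: "\<not> ?thesis"
    obtain i where "w i > 0"
      using w(1,2) by (metis less_eq_real_def sum.neutral zero_neq_one)
    moreover have "w j > 0" if "(j, i) \<in> {(j, i). a i j > 0}" "w i > 0" for j i
      using support_closed[OF b w(1) w(3), of i j] that none by (auto simp: b_def)
    ultimately have "w r > 0" using root_inherits[OF reach[of i], of "\<lambda>i. w i > 0"] by blast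
    then show False using none \<open>r \<in> S\<close> by blast
  qed
  then have \<sigma>: "\<sigma> > 0" unfolding \<sigma>_def by (meson finite sum_pos2 w(1))
  have "v i > 0" if "i \<notin> S" for i
  proof -
    have "0 \<le> (\<Sum>k\<in>UNIV. v k * a k i)"
      by (intro sum_nonneg mult_nonneg_nonneg a) (simp add: v_def w)
    then have "0 < v i * (\<Sum>j\<in>UNIV. a i j)" using drift_v[OF that] \<sigma> by (simp add: drift_def)
    then have "v i \<noteq> 0" by auto
    then show ?thesis using w(1)[of i] that by (simp add: v_def)
  qed
  then show ?thesis using \<sigma> drift_v by (intro exI[of _ v] exI[of _ \<sigma>]) (simp add: v_def)
qed

text \<open>
  The quadratic form vanishes at constant vectors, so coercivity needs a restriction on
  \<open>s\<close>.  The restriction is phrased by signs, without strictness, because that is what passes from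
  \<open>y\<close>, which is orthogonal to \<open>p\<close>, to its nonlinear image \<open>s\<close>.
\<close>

lemma coercive_weights_exist:
  fixes a :: "'n::finite \<Rightarrow> 'n \<Rightarrow> real"
  assumes a: "\<And>i j. a i j \<ge> 0" and reach: "\<And>i. (r, i) \<in> {(j, i). a i j > 0}\<^sup>*"
  shows "\<exists>p w c. (\<forall>i. p i \<ge> 0) \<and> (\<forall>k. drift a p k = 0) \<and> (\<forall>i. w i > 0) \<and> c > 0 \<and>
    (\<forall>s. (\<forall>i. p i > 0 \<longrightarrow> (\<exists>j. p j > 0 \<and> s i * s j \<le> 0)) \<longrightarrow>
       c * (\<Sum>i\<in>UNIV. (s i)\<^sup>2) \<le> (\<Sum>i\<in>UNIV. w i * s i * (\<Sum>j\<in>UNIV. a i j * (s i - s j))))"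
proof -
  obtain p where p: "\<And>i. p i \<ge> 0" "sum p UNIV = 1" "\<And>k. drift a p k = 0"
    using stationary_distribution_exists[of a, OF a] by blast
  define S where "S = {i. p i > 0}"
  obtain i0 where "p i0 > 0"
    using p(1,2) by (metis less_eq_real_def sum.neutral zero_neq_one)
  then have "p r > 0"
    using root_inherits[OF reach[of i0], of "\<lambda>i. p i > 0"] support_closed[OF a p(1) p(3)] by blast
  then have "r \<in> S" by (simp add: S_def)
  obtain v \<sigma> where v: "\<sigma> > 0" "\<And>i. i \<in> S \<Longrightarrow> v i = 0" "\<And>i. i \<notin> S \<Longrightarrow> v i > 0"
    "\<And>i. i \<notin> S \<Longrightarrow> drift a v i = \<sigma>"
    using follower_weights_exist[of a r S, OF a reach \<open>r \<in> S\<close>] by blast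
  have "\<forall>i. \<exists>C\<ge>0. p i > 0 \<longrightarrow> (\<forall>s. (s r - s i)\<^sup>2 \<le> C * disagreement a p s)"
    using disagreement_bounds_path[OF a p(1) p(3) reach] by (metis order_refl)
  then obtain C where C: "\<And>i. C i \<ge> 0"
    "\<And>i s. p i > 0 \<Longrightarrow> (s r - s i)\<^sup>2 \<le> C i * disagreement a p s"
    by metis
  define K where "K = real CARD('n) * (4 * sum C UNIV) + 1"
  have "0 \<le> real CARD('n) * (4 * sum C UNIV)" by (intro sum_nonneg mult_nonneg_nonneg C) auto
  then have K: "K > 0" unfolding K_def by linarith
  define G where "G = (\<Sum>k\<in>UNIV. \<bar>drift a v k\<bar>)"
  have G: "\<bar>drift a v k\<bar> \<le> G" for k unfolding G_def by (rule member_le_sum) auto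
  then have G0: "G \<ge> 0" by (meson abs_ge_zero order_trans)
  (* K bounds the squares on S by the disagreement, and G bounds the negative drift of v on S;
     with this choice of \<delta> the drift costs at most half of the disagreement. *)
  define \<delta> where "\<delta> = 1 / (2 * K * (G + 1))"
  have \<delta>: "\<delta> > 0" using K G0 by (simp add: \<delta>_def)
  have "\<delta> * G \<le> \<delta> * (G + 1)" using \<delta> by simp
  also have "\<dots> = 1 / (2 * K)" using G0 K by (simp add: \<delta>_def)
  finally have \<delta>G: "\<delta> * G \<le> 1 / (2 * K)" .
  define w where "w i = p i + \<delta> * v i" for i
  define c where "c = min (1 / (2 * K)) (\<delta> * \<sigma>) / 2"
  have v0: "v i \<ge> 0" for i using v(2)[of i] v(3)[of i] by (cases "i \<in> S") auto
  have "w i > 0" for i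
  proof (cases "i \<in> S")
    case True then show ?thesis using v(2)[of i] by (simp add: w_def S_def)
  next
    case False then show ?thesis using v(3)[of i] \<delta> p(1)[of i] by (simp add: w_def add_nonneg_pos)
  qed
  moreover have "c > 0" using K \<delta> v(1) by (simp add: c_def)
  moreover have "c * (\<Sum>i\<in>UNIV. (s i)\<^sup>2) \<le> (\<Sum>i\<in>UNIV. w i * s i * (\<Sum>j\<in>UNIV. a i j * (s i - s j)))"
    if mixed: "\<And>i. p i > 0 \<Longrightarrow> \<exists>j. p j > 0 \<and> s i * s j \<le> 0" for s
  proof -
    let ?D = "disagreement a p s"
    have D0: "?D \<ge> 0" by (rule disagreement_nonneg[OF a p(1)])
    have "(s i)\<^sup>2 \<le> 4 * sum C UNIV * ?D" if "i \<in> S" for i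
    proof -
      have i: "p i > 0" using that by (simp add: S_def)
      then obtain j where j: "p j > 0" "s i * s j \<le> 0" using mixed by blast
      have CD: "(s r - s k)\<^sup>2 \<le> sum C UNIV * ?D" if "p k > 0" for k
      proof -
        have "C k \<le> sum C UNIV" by (rule member_le_sum) (auto simp: C)
        then show ?thesis using C(2)[OF that, of s] D0 by (meson mult_right_mono order_trans)
      qed
      have "(s i)\<^sup>2 \<le> (s i - s j)\<^sup>2" using j(2) zero_le_power2[of "s j"]
        unfolding power2_diff by linarith
      also have "\<dots> \<le> 2 * (s r - s i)\<^sup>2 + 2 * (s r - s j)\<^sup>2"
        using zero_le_power2[of "(s r - s j) + (s r - s i)"] by (simp add: power2_eq_square algebra_simps)
      also have "\<dots> \<le> 4 * sum C UNIV * ?D" using CD[OF i] CD[OF j(1)] by simp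
      finally show ?thesis .
    qed
    then have "(\<Sum>i\<in>S. (s i)\<^sup>2) \<le> (\<Sum>i\<in>S. 4 * sum C UNIV * ?D)" by (rule sum_mono)
    also have "\<dots> \<le> (\<Sum>i\<in>(UNIV :: 'n set). 4 * sum C UNIV * ?D)"
      by (rule sum_mono2) (auto intro!: mult_nonneg_nonneg D0 sum_nonneg C)
    also have "\<dots> \<le> K * ?D" using D0 by (simp add: K_def algebra_simps)
    finally have S_bound: "(\<Sum>i\<in>S. (s i)\<^sup>2) / K \<le> ?D" using K by (simp add: field_simps)
    have "disagreement a w s = ?D + \<delta> * disagreement a v s"
      by (simp add: disagreement_def w_def algebra_simps sum.distrib sum_distrib_left)
    moreover have "disagreement a v s \<ge> 0" by (rule disagreement_nonneg[OF a v0])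
    ultimately have D_le: "?D \<le> disagreement a w s" using \<delta> by simp
    have "drift a w i = drift a p i + \<delta> * drift a v i" for i
      by (simp add: drift_def w_def algebra_simps sum.distrib sum_distrib_left)
    then have drift_w: "drift a w i = \<delta> * drift a v i" for i using p(3) by simp
    have split: "(\<Sum>i\<in>UNIV. f i) = (\<Sum>i\<in>S. f i) + (\<Sum>i\<in>-S. f i)" for f :: "'n \<Rightarrow> real"
      using sum.union_disjoint[of S "-S" f] by (simp add: Compl_partition)
    have on_S: "- (1 / (2 * K)) * (\<Sum>i\<in>S. (s i)\<^sup>2) \<le> (\<Sum>i\<in>S. drift a w i * (s i)\<^sup>2)"
      unfolding sum_distrib_left
    proof (intro sum_mono mult_right_mono)
      fix i
      have "- G \<le> drift a v i" using G[of i] by linarith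
      then have "\<delta> * (- G) \<le> drift a w i" unfolding drift_w using \<delta> by (intro mult_left_mono) auto
      then show "- (1 / (2 * K)) \<le> drift a w i" using \<delta>G by simp
    qed simp
    have off_S: "(\<Sum>i\<in>-S. drift a w i * (s i)\<^sup>2) = \<delta> * \<sigma> * (\<Sum>i\<in>-S. (s i)\<^sup>2)"
      by (simp add: sum_distrib_left drift_w v(4))
    have "2 * (c * (\<Sum>i\<in>UNIV. (s i)\<^sup>2))
        = 2 * c * (\<Sum>i\<in>S. (s i)\<^sup>2) + 2 * c * (\<Sum>i\<in>-S. (s i)\<^sup>2)"
      by (simp add: split algebra_simps)
    also have "\<dots> \<le> 1 / (2 * K) * (\<Sum>i\<in>S. (s i)\<^sup>2) + \<delta> * \<sigma> * (\<Sum>i\<in>-S. (s i)\<^sup>2)"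
      by (intro add_mono mult_right_mono sum_nonneg) (auto simp: c_def)
    also have "\<dots> \<le> disagreement a w s + (\<Sum>i\<in>UNIV. drift a w i * (s i)\<^sup>2)"
    proof -
      have "(\<Sum>i\<in>S. (s i)\<^sup>2) / K = 2 * (1 / (2 * K) * (\<Sum>i\<in>S. (s i)\<^sup>2))" by simp
      then show ?thesis using S_bound D_le on_S off_S unfolding split mult_minus_left by linarith
    qed
    finally show ?thesis unfolding dissipation_identity[symmetric] by simp
  qed
  ultimately show ?thesis using p(1,3) by blast
qed

section \<open>Finite-time decay\<close>

lemma nonincreasing_from_right_derivative:
  fixes V :: "real \<Rightarrow> real"
  assumes der: "\<And>t. t \<ge> 0 \<Longrightarrow> (V has_real_derivative V' t) (at t within {0..})"
    and "0 \<le> s" "s \<le> t" and nonpos: "\<And>u. s \<le> u \<Longrightarrow> u \<le> t \<Longrightarrow> V' u \<le> 0"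
  shows "V t \<le> V s"
proof (rule DERIV_nonpos_imp_decreasing_open[OF \<open>s \<le> t\<close>])
  fix u assume u: "s < u" "u < t"
  then have "at u within {0..} = at u"
    using \<open>0 \<le> s\<close> by (intro at_within_interior) simp
  then show "\<exists>y. (V has_real_derivative y) (at u) \<and> y \<le> 0"
    using der[of u] nonpos[of u] u \<open>0 \<le> s\<close> by force
next
  have "continuous_on {0..} V"
    unfolding continuous_on_eq_continuous_within using der by (auto intro: DERIV_continuous)
  then show "continuous_on {s..t} V"
    by (rule continuous_on_subset) (use \<open>0 \<le> s\<close> in auto)
qed

text \<open>
  As long as \<open>V\<close> is positive, $V^{1-\gamma}$ decreases at least at the constant rate
  $k (1 - \gamma)$, which it cannot do beyond the time \<open>T\<close> below without becoming negative.
\<close>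

lemma finite_time_extinction:
  fixes V :: "real \<Rightarrow> real"
  assumes der: "\<And>t. t \<ge> 0 \<Longrightarrow> (V has_real_derivative V' t) (at t within {0..})"
    and nonneg: "\<And>t. t \<ge> 0 \<Longrightarrow> V t \<ge> 0"
    and decay: "\<And>t. t \<ge> 0 \<Longrightarrow> V' t \<le> - k * V t powr \<gamma>"
    and "k > 0" "\<gamma> < 1"
  shows "\<exists>T\<ge>0. \<forall>t\<ge>T. V t = 0"
proof -
  define m where "m = k * (1 - \<gamma>)"
  have m: "m > 0" using \<open>k > 0\<close> \<open>\<gamma> < 1\<close> by (simp add: m_def)
  define T where "T = (V 0 powr (1 - \<gamma>) + 1) / m"
  have T: "T \<ge> 0" using m by (simp add: T_def)
  have V'_nonpos: "V' t \<le> 0" if "t \<ge> 0" for t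
  proof -
    have "- k * V t powr \<gamma> \<le> 0" using \<open>k > 0\<close> by simp
    then show ?thesis using decay[OF that] by linarith
  qed
  have mono: "V t \<le> V s" if "0 \<le> s" "s \<le> t" for s t
    by (rule nonincreasing_from_right_derivative[OF der that]) (use V'_nonpos that in auto)
  have "V T = 0"
  proof (rule ccontr)
    assume "V T \<noteq> 0"
    then have pos: "V t > 0" if "0 \<le> t" "t \<le> T" for t
      using nonneg[OF T] mono[OF that] by linarith
    have "continuous_on {0..} V"
      unfolding continuous_on_eq_continuous_within using der by (auto intro: DERIV_continuous)
    then have "continuous_on {0..T} V"
      by (rule continuous_on_subset) auto
    then have "continuous_on {0..T} (\<lambda>t. V t powr (1 - \<gamma>) + m * t)"
      using pos by (intro continuous_intros) force+
    moreover have "\<exists>y. ((\<lambda>t. V t powr (1 - \<gamma>) + m * t) has_real_derivative y) (at t) \<and> y \<le> 0"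
      if t: "0 < t" "t < T" for t
    proof -
      have Vt: "V t > 0" using pos t by simp
      have "at t within {0..} = at t" using t by (intro at_within_interior) simp
      then have "(V has_real_derivative V' t) (at t)" using der[of t] t by simp
      then have "((\<lambda>t. V t powr (1 - \<gamma>) + m * t) has_real_derivative
          (1 - \<gamma>) * V t powr (1 - \<gamma> - 1) * V' t + m) (at t)"
        using Vt by (auto intro!: derivative_eq_intros DERIV_chain'[of V _ _ _ "\<lambda>v. v powr (1 - \<gamma>)"]
            has_real_derivative_powr)
      moreover have "V t powr (- \<gamma>) * V' t \<le> V t powr (- \<gamma>) * (- k * V t powr \<gamma>)"
        using decay[of t] t by (intro mult_left_mono) auto
      then have "V t powr (- \<gamma>) * V' t \<le> - k" using Vt by (simp add: powr_minus field_simps)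
      then have "(1 - \<gamma>) * (V t powr (- \<gamma>) * V' t) \<le> (1 - \<gamma>) * (- k)"
        using \<open>\<gamma> < 1\<close> by (intro mult_left_mono) auto
      ultimately show ?thesis by (auto simp: m_def algebra_simps)
    qed
    ultimately have "V T powr (1 - \<gamma>) + m * T \<le> V 0 powr (1 - \<gamma>) + m * 0"
      by (intro DERIV_nonpos_imp_decreasing_open[OF T]) auto
    moreover have "m * T = V 0 powr (1 - \<gamma>) + 1" using m by (simp add: T_def)
    moreover have "V T powr (1 - \<gamma>) \<ge> 0" by simp
    ultimately show False by linarith
  qed
  then have "V t = 0" if "t \<ge> T" for t
    using mono[OF T that] nonneg[of t] T that by linarith
  then show ?thesis using T by blast
qed

section \<open>Signed powers and the energy\<close>

lemma abs_sig: "a > 0 \<Longrightarrow> \<bar>sig r a\<bar> = \<bar>r\<bar> powr a"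
  by (cases "r = 0") (auto simp: sig_def abs_mult)

lemma sgn_sig: "sgn (sig r a) = sgn r"
  by (cases "r = 0") (auto simp: sig_def sgn_mult)

lemma has_real_derivative_abs_powr:
  assumes "a > 0"
  shows "((\<lambda>r. \<bar>r\<bar> powr (1 + a)) has_real_derivative (1 + a) * sig r a) (at r)"
proof -
  consider "r > 0" | "r < 0" | "r = 0" by linarith
  then show ?thesis
  proof cases
    case 1
    have "((\<lambda>r. r powr (1 + a)) has_real_derivative (1 + a) * r powr (1 + a - 1)) (at r)"
      using 1 by (rule has_real_derivative_powr)
    then have "((\<lambda>r. \<bar>r\<bar> powr (1 + a)) has_real_derivative (1 + a) * r powr (1 + a - 1)) (at r)"
      by (rule has_field_derivative_transform_within_open[where S = "{0<..}"]) (use 1 in auto)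
    then show ?thesis using 1 by (simp add: sig_def)
  next
    case 2
    have "((\<lambda>r. (- r) powr (1 + a)) has_real_derivative (1 + a) * (- r) powr (1 + a - 1) * - 1) (at r)"
      using 2 by (intro DERIV_chain'[of uminus _ _ _ "\<lambda>v. v powr (1 + a)", THEN DERIV_cong]
          has_real_derivative_powr derivative_eq_intros) auto
    then have "((\<lambda>r. \<bar>r\<bar> powr (1 + a)) has_real_derivative (1 + a) * (- r) powr (1 + a - 1) * - 1) (at r)"
      by (rule has_field_derivative_transform_within_open[where S = "{..<0}"]) (use 2 in auto)
    then show ?thesis using 2 by (simp add: sig_def)
  next
    case 3
    have "((\<lambda>h. sig h a) \<longlongrightarrow> 0) (at 0)"
    proof (rule Lim_null_comparison)
      show "\<forall>\<^sub>F h in at 0. norm (sig h a) \<le> \<bar>h\<bar> powr a" using assms by (simp add: abs_sig)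
      have "((\<lambda>h. \<bar>h\<bar> powr a) \<longlongrightarrow> \<bar>0\<bar> powr a) (at (0::real))"
        using assms by (intro tendsto_powr' tendsto_rabs tendsto_ident_at tendsto_const) auto
      then show "((\<lambda>h::real. \<bar>h\<bar> powr a) \<longlongrightarrow> 0) (at 0)" by simp
    qed
    moreover have "(\<bar>h\<bar> powr (1 + a)) / h = sig h a" if "h \<noteq> 0" for h :: real
      using that by (auto simp: sig_def powr_add sgn_if)
    ultimately have "((\<lambda>h::real. \<bar>h\<bar> powr (1 + a) / h) \<longlongrightarrow> 0) (at 0)"
      by (metis (no_types, lifting) LIM_equal)
    then show ?thesis using 3 assms by (simp add: DERIV_def sig_def)
  qed
qed

text \<open>
  The exponents $e_i = 2 \alpha_i / (1 + \alpha_i)$ with $s_i^2 = (|y_i|^{1+\alpha_i})^{e_i}$ differ from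
  vertex to vertex.  For numbers at most 1 the largest exponent gives the smallest power, so $\gamma$ is
  their maximum; the a priori bound \<open>R\<close> on the energy permits rescaling by \<open>\<kappa>\<close> into
  that range.  The second summand of $1 / \kappa$ ensures that some vertex has
  $|y_i|^{1+\alpha_i} \ge \kappa V$.
\<close>

lemma energy_powr_le_sum_squares:
  fixes \<mu> \<alpha> :: "'n::finite \<Rightarrow> real"
  assumes \<alpha>: "\<And>i. 0 < \<alpha> i" "\<And>i. \<alpha> i < 1" and \<mu>: "\<And>i. \<mu> i > 0" and "R > 0"
  shows "\<exists>k \<gamma>. k > 0 \<and> \<gamma> < 1 \<and> (\<forall>y. (\<Sum>i\<in>UNIV. \<mu> i * \<bar>y i\<bar> powr (1 + \<alpha> i)) \<le> R \<longrightarrow>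
    k * (\<Sum>i\<in>UNIV. \<mu> i * \<bar>y i\<bar> powr (1 + \<alpha> i)) powr \<gamma> \<le> (\<Sum>i\<in>UNIV. (sig (y i) (\<alpha> i))\<^sup>2))"
proof -
  define e where "e i = 2 * \<alpha> i / (1 + \<alpha> i)" for i
  have e: "e i > 0" "e i < 1" for i
    using \<alpha>(1)[of i] \<alpha>(2)[of i] by (auto simp: e_def divide_simps)
  define \<gamma> where "\<gamma> = Max (range e)"
  have e_le: "e i \<le> \<gamma>" for i by (simp add: \<gamma>_def)
  have "\<gamma> < 1" using e by (simp add: \<gamma>_def)
  define \<kappa> where "\<kappa> = 1 / (R + sum \<mu> UNIV)"
  have "sum \<mu> UNIV > 0" using \<mu> by (intro sum_pos) auto
  then have \<kappa>: "\<kappa> > 0" "\<kappa> * R \<le> 1" "\<kappa> * sum \<mu> UNIV \<le> 1"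
    using \<open>R > 0\<close> by (auto simp: \<kappa>_def)
  have "\<kappa> powr \<gamma> * V powr \<gamma> \<le> (\<Sum>i\<in>UNIV. (sig (y i) (\<alpha> i))\<^sup>2)"
    if V: "V = (\<Sum>i\<in>UNIV. \<mu> i * \<bar>y i\<bar> powr (1 + \<alpha> i))" and "V \<le> R" for y V
  proof -
    have V0: "V \<ge> 0" unfolding V using \<mu> by (intro sum_nonneg) (simp add: less_imp_le)
    have "\<exists>i. \<kappa> * V \<le> \<bar>y i\<bar> powr (1 + \<alpha> i)"
    proof (rule ccontr)
      assume "\<not> ?thesis"
      then have less: "\<bar>y i\<bar> powr (1 + \<alpha> i) < \<kappa> * V" for i by (simp add: not_le)
      have "V < (\<Sum>i\<in>UNIV. \<mu> i * (\<kappa> * V))"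
        unfolding V by (rule sum_strict_mono) (use less V \<mu> in auto)
      also have "\<dots> = \<kappa> * sum \<mu> UNIV * V" by (simp add: sum_distrib_left sum_distrib_right mult_ac)
      also have "\<dots> \<le> 1 * V" using \<kappa>(3) V0 by (rule mult_right_mono)
      finally show False by simp
    qed
    then obtain i where i: "\<kappa> * V \<le> \<bar>y i\<bar> powr (1 + \<alpha> i)" by blast
    have "\<kappa> * V \<le> \<kappa> * R" using \<kappa>(1) \<open>V \<le> R\<close> by simp
    then have "\<kappa> * V \<le> 1" using \<kappa>(2) by linarith
    then have "(\<kappa> * V) powr \<gamma> \<le> (\<kappa> * V) powr e i"
      using e_le V0 \<kappa>(1) by (intro powr_mono') auto
    also have "\<dots> \<le> (\<bar>y i\<bar> powr (1 + \<alpha> i)) powr e i"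
      using i V0 \<kappa>(1) e(1)[of i] by (intro powr_mono2) auto
    also have "\<dots> = \<bar>y i\<bar> powr (2 * \<alpha> i)"
      using \<alpha>(1)[of i] by (simp add: powr_powr e_def)
    also have "\<dots> = (sig (y i) (\<alpha> i))\<^sup>2"
    proof -
      have "(sig (y i) (\<alpha> i))\<^sup>2 = (\<bar>y i\<bar> powr \<alpha> i)\<^sup>2"
        using abs_sig[OF \<alpha>(1)] by (metis power2_abs)
      then show ?thesis by (simp add: powr_add[symmetric] power2_eq_square)
    qed
    also have "\<dots> \<le> (\<Sum>i\<in>UNIV. (sig (y i) (\<alpha> i))\<^sup>2)"
      by (rule member_le_sum) auto
    finally show ?thesis using \<kappa>(1) V0 by (simp add: powr_mult)
  qed
  then show ?thesis using \<kappa>(1) \<open>\<gamma> < 1\<close>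
    by (intro exI[of _ "\<kappa> powr \<gamma>"] exI[of _ \<gamma>]) auto
qed

section \<open>Sign patterns and equilibria\<close>

lemma mixed_signs_of_weighted_sum_zero:
  fixes p y s :: "'n::finite \<Rightarrow> real"
  assumes p: "\<And>i. p i \<ge> 0" and zero: "(\<Sum>i\<in>UNIV. p i * y i) = 0"
    and sgn: "\<And>i. sgn (s i) = sgn (y i)" and "p i > 0"
  shows "\<exists>j. p j > 0 \<and> s i * s j \<le> 0"
proof (rule ccontr)
  assume "\<not> ?thesis"
  then have *: "s i * s j > 0" if "p j > 0" for j using that by (meson not_le)
  have "y i * y j > 0" if "p j > 0" for j
    using *[OF that] sgn[of i] sgn[of j] by (metis sgn_greater sgn_mult)
  then have "0 \<le> p j * (y i * y j)" for j
    using p[of j] by (cases "p j = 0") (auto intro!: mult_nonneg_nonneg simp: less_imp_le less_le)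
  moreover have "0 < p i * (y i * y i)" using \<open>p i > 0\<close> \<open>p i > 0 \<Longrightarrow> y i * y i > 0\<close> by simp
  ultimately have "0 < (\<Sum>j\<in>UNIV. p j * (y i * y j))" by (intro sum_pos2[of _ i]) auto
  also have "\<dots> = y i * (\<Sum>j\<in>UNIV. p j * y j)" by (simp add: sum_distrib_left mult_ac)
  finally show False using zero by simp
qed

text \<open>
  The maximum principle: where \<open>x\<close> is maximal, a weighted sum of nonpositive differences is zero, so all
  in-neighbours attain the maximum too, and so does the root.
\<close>

lemma harmonic_imp_le_root:
  fixes a :: "'n::finite \<Rightarrow> 'n \<Rightarrow> real"
  assumes a: "\<And>i j. a i j \<ge> 0" and reach: "\<And>i. (r, i) \<in> {(j, i). a i j > 0}\<^sup>*"
    and harm: "\<And>i. (\<Sum>j\<in>UNIV. a i j * (x j - x i)) = 0"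
  shows "x k \<le> (x r :: real)"
proof -
  define M where "M = Max (range x)"
  have le: "x j \<le> M" for j by (simp add: M_def)
  have "M \<in> range x" unfolding M_def by (rule Max_in) auto
  then obtain i where "x i = M" by auto
  moreover have "x j = M" if "(j, i) \<in> {(j, i). a i j > 0}" "x i = M" for j i
  proof -
    have "(\<Sum>j\<in>UNIV. a i j * (M - x j)) = - (\<Sum>j\<in>UNIV. a i j * (x j - x i))"
      by (simp add: that sum_negf[symmetric] algebra_simps)
    then have "(\<Sum>j\<in>UNIV. a i j * (M - x j)) = 0" using harm by simp
    then have "a i j * (M - x j) = 0"
      using a le by (subst (asm) sum_nonneg_eq_0_iff) (auto intro!: mult_nonneg_nonneg)
    then show ?thesis using that(1) by simp
  qed
  ultimately have "x r = M"
    using root_inherits[OF reach[of i], of "\<lambda>i. x i = M"] by blast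
  then show ?thesis using le by simp
qed

lemma harmonic_imp_constant:
  fixes a :: "'n::finite \<Rightarrow> 'n \<Rightarrow> real"
  assumes a: "\<And>i j. a i j \<ge> 0" and reach: "\<And>i. (r, i) \<in> {(j, i). a i j > 0}\<^sup>*"
    and harm: "\<And>i. (\<Sum>j\<in>UNIV. a i j * (x j - x i)) = 0"
  shows "x k = (x r :: real)"
proof (rule antisym)
  show "x k \<le> x r" by (rule harmonic_imp_le_root[OF a reach harm])
  have "(\<Sum>j\<in>UNIV. a i j * (- x j - - x i)) = 0" for i
  proof -
    have "(\<Sum>j\<in>UNIV. a i j * (- x j - - x i)) = - (\<Sum>j\<in>UNIV. a i j * (x j - x i))"
      by (simp add: sum_negf[symmetric] algebra_simps)
    then show ?thesis by (simp add: harm)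
  qed
  then have "- x k \<le> - x r" by (rule harmonic_imp_le_root[OF a reach])
  then show "x r \<le> x k" by simp
qed

section \<open>Convergence of the protocol\<close>

lemma stationary_annihilates_differences:
  fixes a :: "'n::finite \<Rightarrow> 'n \<Rightarrow> real"
  assumes "\<And>k. drift a p k = 0"
  shows "(\<Sum>i\<in>UNIV. p i * (\<Sum>j\<in>UNIV. a i j * (x j - x i))) = 0"
proof -
  have "(\<Sum>i\<in>UNIV. \<Sum>j\<in>UNIV. p i * a i j * x j) = (\<Sum>k\<in>UNIV. (\<Sum>i\<in>UNIV. p i * a i k) * x k)"
    by (subst sum.swap) (simp add: sum_distrib_right)
  also have "\<dots> = (\<Sum>k\<in>UNIV. p k * (\<Sum>j\<in>UNIV. a k j) * x k)"
    using assms by (simp add: drift_def)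
  finally show ?thesis
    by (simp add: right_diff_distrib sum_subtractf sum_distrib_left sum_distrib_right mult_ac)
qed

lemma finite_time_equilibrium:
  fixes a :: "'n::finite \<Rightarrow> 'n \<Rightarrow> real" and x :: "real \<Rightarrow> 'n \<Rightarrow> real"
  assumes a: "\<And>i j. a i j \<ge> 0" and reach: "\<And>i. (r, i) \<in> {(j, i). a i j > 0}\<^sup>*"
    and \<alpha>: "\<And>i. 0 < \<alpha> i" "\<And>i. \<alpha> i < 1"
    and x: "\<And>t i. t \<ge> 0 \<Longrightarrow> ((\<lambda>t. x t i) has_real_derivative
               sig (\<Sum>j\<in>UNIV. a i j * (x t j - x t i)) (\<alpha> i)) (at t within {0..})"
  shows "\<exists>T\<ge>0. \<forall>t\<ge>T. \<forall>i. (\<Sum>j\<in>UNIV. a i j * (x t j - x t i)) = 0"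
proof -
  define y where "y t i = (\<Sum>j\<in>UNIV. a i j * (x t j - x t i))" for t i
  define s where "s t i = sig (y t i) (\<alpha> i)" for t i
  obtain p w c where p: "\<And>i. p i \<ge> 0" "\<And>k. drift a p k = 0" and w: "\<And>i. w i > 0" and c: "c > 0"
    and coercive: "\<And>s. (\<And>i. p i > 0 \<Longrightarrow> \<exists>j. p j > 0 \<and> s i * s j \<le> 0) \<Longrightarrow>
      c * (\<Sum>i\<in>UNIV. (s i)\<^sup>2) \<le> (\<Sum>i\<in>UNIV. w i * s i * (\<Sum>j\<in>UNIV. a i j * (s i - s j)))"
    using coercive_weights_exist[of a r, OF a reach] by blast
  define \<mu> where "\<mu> i = w i / (1 + \<alpha> i)" for i
  have \<mu>: "\<mu> i > 0" "\<mu> i * (1 + \<alpha> i) = w i" for i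
    using w[of i] \<alpha>(1)[of i] by (auto simp: \<mu>_def)
  define V where "V t = (\<Sum>i\<in>UNIV. \<mu> i * \<bar>y t i\<bar> powr (1 + \<alpha> i))" for t
  define V' where "V' t = - (\<Sum>i\<in>UNIV. w i * s t i * (\<Sum>j\<in>UNIV. a i j * (s t i - s t j)))" for t
  have dy: "((\<lambda>t. y t i) has_real_derivative (\<Sum>j\<in>UNIV. a i j * (s t j - s t i))) (at t within {0..})"
    if "t \<ge> 0" for t i
    unfolding y_def s_def by (intro DERIV_sum DERIV_cmult DERIV_diff x that)
  have dV: "(V has_real_derivative V' t) (at t within {0..})" if "t \<ge> 0" for t
  proof -
    have "(V has_real_derivative (\<Sum>i\<in>UNIV. \<mu> i * ((1 + \<alpha> i) * sig (y t i) (\<alpha> i)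
        * (\<Sum>j\<in>UNIV. a i j * (s t j - s t i))))) (at t within {0..})"
      unfolding V_def[abs_def]
      by (intro DERIV_sum DERIV_cmult DERIV_chain'[OF dy[OF that] has_real_derivative_abs_powr[OF \<alpha>(1)]])
    moreover have "\<mu> i * ((1 + \<alpha> i) * sig (y t i) (\<alpha> i) * (\<Sum>j\<in>UNIV. a i j * (s t j - s t i)))
        = - (w i * s t i * (\<Sum>j\<in>UNIV. a i j * (s t i - s t j)))" for i
    proof -
      have "(\<Sum>j\<in>UNIV. a i j * (s t j - s t i)) = - (\<Sum>j\<in>UNIV. a i j * (s t i - s t j))"
        by (simp add: sum_negf[symmetric] algebra_simps)
      then show ?thesis by (simp add: \<mu>(2)[of i, symmetric] s_def)
    qed
    ultimately show ?thesis by (simp add: V'_def sum_negf)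
  qed
  have V'_le: "V' t \<le> - c * (\<Sum>i\<in>UNIV. (s t i)\<^sup>2)" for t
  proof -
    have "(\<Sum>i\<in>UNIV. p i * y t i) = 0"
      unfolding y_def by (rule stationary_annihilates_differences[OF p(2)])
    then have "\<exists>j. p j > 0 \<and> s t i * s t j \<le> 0" if "p i > 0" for i
      using that by (intro mixed_signs_of_weighted_sum_zero[of p "y t"] p(1)) (auto simp: s_def sgn_sig)
    from coercive[of "s t", OF this] show ?thesis by (simp add: V'_def)
  qed
  have V'_nonpos: "V' t \<le> 0" for t
  proof -
    have "0 \<le> c * (\<Sum>i\<in>UNIV. (s t i)\<^sup>2)" using c by (intro mult_nonneg_nonneg sum_nonneg) auto
    then show ?thesis using V'_le[of t] by linarith
  qed
  have V_nonneg: "V t \<ge> 0" for t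
    unfolding V_def by (intro sum_nonneg mult_nonneg_nonneg) (simp_all add: less_imp_le \<mu>)
  (* The summand 1 makes the bound positive even if the solution starts at consensus. *)
  have V_le: "V t \<le> V 0 + 1" if "t \<ge> 0" for t
    using nonincreasing_from_right_derivative[OF dV, of 0 t] V'_nonpos that by simp
  obtain k \<gamma> where k: "k > 0" and \<gamma>: "\<gamma> < 1" and
    energy: "\<And>t. V t \<le> V 0 + 1 \<Longrightarrow> k * V t powr \<gamma> \<le> (\<Sum>i\<in>UNIV. (s t i)\<^sup>2)"
    using energy_powr_le_sum_squares[of \<alpha> \<mu> "V 0 + 1", OF \<alpha> \<mu>(1)] V_nonneg[of 0]
    unfolding V_def s_def by fastforce
  have "V' t \<le> - (c * k) * V t powr \<gamma>" if "t \<ge> 0" for t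
  proof -
    have "c * (k * V t powr \<gamma>) \<le> c * (\<Sum>i\<in>UNIV. (s t i)\<^sup>2)"
      using c energy[OF V_le[OF that]] by (intro mult_left_mono) auto
    then show ?thesis using V'_le[of t] by simp
  qed
  then obtain T where T: "T \<ge> 0" "\<And>t. t \<ge> T \<Longrightarrow> V t = 0"
    using finite_time_extinction[of V V' "c * k" \<gamma>, OF dV V_nonneg _ _ \<gamma>] c k by auto
  have "y t i = 0" if "t \<ge> T" for t i
  proof -
    have "\<mu> i * \<bar>y t i\<bar> powr (1 + \<alpha> i) = 0"
      using T(2)[OF that] unfolding V_def
      by (subst (asm) sum_nonneg_eq_0_iff) (auto intro!: mult_nonneg_nonneg simp: less_imp_le \<mu>)
    then show ?thesis using \<mu>(1)[of i] by simp
  qed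
  then show ?thesis using T(1) unfolding y_def by blast
qed

theorem theorem1:
  fixes A :: "real^'n^'n" and \<alpha> :: "real^'n"
  assumes nonneg: "\<And>i j. A $ i $ j \<ge> 0"
    and zero_diag: "\<And>i. A $ i $ i = 0"
    and alpha: "\<And>i. 0 < \<alpha> $ i \<and> \<alpha> $ i < 1"
    and tree: "has_spanning_tree (graph_edges A)"
  shows "solves_finite_time_consensus (consensus_protocol A \<alpha>)"
proof -
  obtain r where reach: "\<And>i. (r, i) \<in> {(j, i). A $ i $ j > 0}\<^sup>*"
    using tree unfolding has_spanning_tree_iff_root graph_edges_def by blast
  have protocol: "consensus_protocol A \<alpha> z $ i = sig (\<Sum>j\<in>UNIV. A $ i $ j * (z $ j - z $ i)) (\<alpha> $ i)"
    for z i
  proof -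
    have "A $ i $ j * (z $ j - z $ i) = 0" if "j \<notin> neighbours A i" for j
      using that nonneg[of i j] by (auto simp: neighbours_def)
    then have "(\<Sum>j\<in>neighbours A i. A $ i $ j * (z $ j - z $ i))
        = (\<Sum>j\<in>UNIV. A $ i $ j * (z $ j - z $ i))"
      by (intro sum.mono_neutral_left) auto
    then show ?thesis by (simp add: consensus_protocol_def)
  qed
  have settles: "\<exists>T\<ge>0. \<exists>\<kappa>. \<forall>t\<ge>T. \<forall>j. x t $ j = \<kappa>"
    if "solution_from (consensus_protocol A \<alpha>) x0 x" for x0 x
  proof -
    have dx: "((\<lambda>t. x t $ i) has_real_derivative
        sig (\<Sum>j\<in>UNIV. A $ i $ j * (x t $ j - x t $ i)) (\<alpha> $ i)) (at t within {0..})" if "t \<ge> 0" for t i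
      using \<open>solution_from _ x0 x\<close> that by (simp add: solution_from_def protocol)
    obtain T where T: "T \<ge> 0" "\<And>t i. t \<ge> T \<Longrightarrow> (\<Sum>j\<in>UNIV. A $ i $ j * (x t $ j - x t $ i)) = 0"
      using finite_time_equilibrium[of "\<lambda>i j. A $ i $ j" r "($) \<alpha>" "\<lambda>t. ($) (x t)"]
        nonneg reach alpha dx by blast
    have agree: "x t $ j = x t $ r" if "t \<ge> T" for t j
      by (rule harmonic_imp_constant[of "\<lambda>i j. A $ i $ j", OF nonneg reach T(2)[OF that]])
    have "\<exists>\<kappa>. \<forall>t\<in>{T..}. x t $ r = \<kappa>"
    proof (rule has_field_derivative_zero_constant)
      fix t assume "t \<in> {T..}"
      then have "((\<lambda>t. x t $ r) has_real_derivative 0) (at t within {0..})"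
        using dx[of t r] T by (simp add: sig_def)
      then show "((\<lambda>t. x t $ r) has_real_derivative 0) (at t within {T..})"
        by (rule DERIV_subset) (use T(1) in auto)
    qed simp
    then obtain \<kappa> where "\<And>t. t \<ge> T \<Longrightarrow> x t $ r = \<kappa>" by auto
    then show ?thesis using agree T(1) by metis
  qed
  have "((\<lambda>t. \<bar>x t $ j - x t $ k\<bar>) \<longlongrightarrow> 0) at_top"
    if sol: "solution_from (consensus_protocol A \<alpha>) x0 x" for x0 x j k
  proof (rule tendsto_eventually)
    obtain T \<kappa> where "\<And>t j. t \<ge> T \<Longrightarrow> x t $ j = \<kappa>" using settles[OF sol] by blast
    then show "\<forall>\<^sub>F t in at_top. \<bar>x t $ j - x t $ k\<bar> = 0"
      unfolding eventually_at_top_linorder by (intro exI[of _ T]) simp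
  qed
  then show ?thesis
    using settles unfolding solves_finite_time_consensus_def solves_consensus_def by blast
qed

end
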